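(* Let $\mathcal{H}$ be a complex Hilbert space and let $A,B\in L(\mathcal{H})$ be such that $R(A+B)$ is closed and $R(A+B)=R(A)\dotplus R(B)$ (that is, $A$ is below $A+B$ in the left minus order). Let $\mathcal{M}$ and $\mathcal{N}$ be two closed subspaces of $\mathcal{H}$ such that $R(A+B)\dotplus\mathcal{M}=\mathcal{H}$ and $\mathcal{N}\dotplus N(A+B)=\mathcal{H}$. Suppose $P,Q\in L(\mathcal{H})$ are idempotents satisfying $A=P(A+B)=(A+B)Q$, such that $P$ agrees with $\mathcal{M}$ and $Q$ agrees with $\mathcal{N}$. Then $$(A+B)^{(1,2)}_{\mathcal{N},\mathcal{M}}=Q\,A^{(1,2)}_{\mathcal{N}_1^*,\mathcal{N}_1}\,P+(I-Q)\,B^{(1,2)}_{\mathcal{N}_2^*,\mathcal{N}_2}\,(I-P),$$ where $\mathcal{N}_1,\mathcal{N}_2,\mathcal{N}_1^*,\mathcal{N}_2^*$ are arbitrary closed subspaces satisfying $$P_{R(A)//\mathcal{N}_1}P+P_{R(B)//\mathcal{N}_2}(I-P)=P_{R(A+B)//\mathcal{M}}$$ and $$Q\,P_{\mathcal{N}_1^*//N(A)}+(I-Q)\,P_{\mathcal{N}_2^*//N(B)}=P_{\mathcal{N}//N(A+B)}.$$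
   Context: $L(\mathcal{H})$ is the algebra of bounded linear operators on $\mathcal{H}$; $R(T)$ and $N(T)$ are the range and null space of $T$; $\dotplus$ denotes a direct (algebraic) sum of linear subspaces (trivial intersection). For closed subspaces $\mathcal{S},\mathcal{T}$ with $\mathcal{S}\dotplus\mathcal{T}=\mathcal{H}$, $P_{\mathcal{S}//\mathcal{T}}$ is the (oblique) projection with range $\mathcal{S}$ and null space $\mathcal{T}$; writing this symbol presupposes $\mathcal{S}\dotplus\mathcal{T}=\mathcal{H}$. Under the hypotheses $R(A)$ and $R(B)$ are closed. The superscript $*$ in $\mathcal{N}_1^*,\mathcal{N}_2^*$ is only part of the name. Reflexive inverses: for $T\in L(\mathcal{H})$ with closed range, and closed subspaces $\mathcal{S},\mathcal{T}$ with $\mathcal{S}\dotplus N(T)=\mathcal{H}$ and $R(T)\dotplus\mathcal{T}=\mathcal{H}$, $T^{(1,2)}_{\mathcal{S},\mathcal{T}}$ denotes the unique $X\in L(\mathcal{H})$ with $TXT=T$, $XTX=X$, $R(X)=\mathcal{S}$, $N(X)=\mathcal{T}$. Agreement: $P$ agrees with $\mathcal{M}$ if there exist closed subspaces $\mathcal{N}_1,\mathcal{N}_2$ (complements of $R(A)$, $R(B)$ respectively) such that $P_{R(A)//\mathcal{N}_1}P+P_{R(B)//\mathcal{N}_2}(I-P)=P_{R(A+B)//\mathcal{M}}$. $Q$ agrees with $\mathcal{N}$ if $Q^*$ agrees with $\mathcal{N}^\perp$ with respect to $A^*,B^*$; equivalently, there exist closed subspaces $\mathcal{N}_1^*,\mathcal{N}_2^*$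 (complements of $N(A)$, $N(B)$ respectively) such that $Q\,P_{\mathcal{N}_1^*//N(A)}+(I-Q)\,P_{\mathcal{N}_2^*//N(B)}=P_{\mathcal{N}//N(A+B)}$. *)

theory Defs
  imports "HOL-Analysis.Analysis"
begin

text \<open>Complex Hilbert spaces. The inner product is antilinear in its first argument.\<close>

class complex_inner = real_normed_vector +
  fixes scaleC :: "complex \<Rightarrow> 'a \<Rightarrow> 'a"  (infixr \<open>*\<^sub>C\<close> 75)
    and cinner :: "'a \<Rightarrow> 'a \<Rightarrow> complex"
  assumes scaleC_add_right: "c *\<^sub>C (x + y) = c *\<^sub>C x + c *\<^sub>C y"
    and scaleC_add_left: "(c + d) *\<^sub>C x = c *\<^sub>C x + d *\<^sub>C x"
    and scaleC_scaleC: "c *\<^sub>C (d *\<^sub>C x) = (c * d) *\<^sub>C x"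
    and scaleC_of_real: "of_real r *\<^sub>C x = r *\<^sub>R x"
    and cinner_commute: "cinner x y = cnj (cinner y x)"
    and cinner_add_right: "cinner x (y + z) = cinner x y + cinner x z"
    and cinner_scaleC_right: "cinner x (c *\<^sub>C y) = c * cinner x y"
    and cinner_self: "cinner x x = of_real ((norm x)\<^sup>2)"

class complex_hilbert_space = complex_inner + complete_space

global_interpretation complex_vector:
  vector_space "scaleC :: complex \<Rightarrow> 'a \<Rightarrow> 'a::complex_inner"
  by unfold_locales
    (simp_all add: scaleC_add_right scaleC_add_left scaleC_scaleC
      scaleC_of_real [where r = 1, simplified])

instantiation complex :: complex_hilbert_space
begin
definition "scaleC c (z::complex) = c * z"
definition "cinner (w::complex) z = cnj w * z"
instance
  by standard
    (simp_all add: scaleC_complex_def cinner_complex_def algebra_simps scaleR_conv_of_real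
      complex_norm_square [symmetric] flip: of_real_power)
end

definition closed_csubspace :: "'a::complex_inner set \<Rightarrow> bool" where
  "closed_csubspace S \<longleftrightarrow> closed S \<and> complex_vector.subspace S"

definition direct_sum :: "'a::complex_inner set \<Rightarrow> 'a set \<Rightarrow> 'a set \<Rightarrow> bool" where
  "direct_sum S T U \<longleftrightarrow> U = {s + t | s t. s \<in> S \<and> t \<in> T} \<and> S \<inter> T = {0}"

definition orthogonal_complement :: "'a::complex_inner set \<Rightarrow> 'a set" where
  "orthogonal_complement S = {x. \<forall>y\<in>S. cinner x y = 0}"

text \<open>
  The type of bounded linear functions of the library is real linear, so the algebra
  of bounded operators on a complex space is the subset of its complex linear elements.
\<close>

definition bounded_operators :: "('a::complex_inner \<Rightarrow>\<^sub>L 'a) set" where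
  "bounded_operators = {T. \<forall>c x. blinfun_apply T (c *\<^sub>C x) = c *\<^sub>C blinfun_apply T x}"

definition op_range :: "('a::complex_inner \<Rightarrow>\<^sub>L 'a) \<Rightarrow> 'a set" where
  "op_range T = range (blinfun_apply T)"

definition op_kernel :: "('a::complex_inner \<Rightarrow>\<^sub>L 'a) \<Rightarrow> 'a set" where
  "op_kernel T = {x. blinfun_apply T x = 0}"

definition cadjoint :: "('a::complex_hilbert_space \<Rightarrow>\<^sub>L 'a) \<Rightarrow> ('a \<Rightarrow>\<^sub>L 'a)" where
  "cadjoint T = (THE S. S \<in> bounded_operators \<and>
     (\<forall>x y. cinner (blinfun_apply T x) y = cinner x (blinfun_apply S y)))"

definition idempotent :: "('a::complex_inner \<Rightarrow>\<^sub>L 'a) \<Rightarrow> bool" where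
  "idempotent E \<longleftrightarrow> E o\<^sub>L E = E"

text \<open>
  The following two operators are meaningful only for closed subspaces \<open>S\<close>, \<open>U\<close> such that
  \<open>direct_sum S U UNIV\<close>, respectively \<open>direct_sum S (op_kernel T) UNIV\<close> and
  \<open>direct_sum (op_range T) U UNIV\<close>, with \<open>op_range T\<close> closed.
\<close>

definition oblique_proj :: "'a::complex_hilbert_space set \<Rightarrow> 'a set \<Rightarrow> ('a \<Rightarrow>\<^sub>L 'a)" where
  "oblique_proj S U =
    (THE E. E \<in> bounded_operators \<and> idempotent E \<and> op_range E = S \<and> op_kernel E = U)"

definition reflexive_inverse ::
    "('a::complex_hilbert_space \<Rightarrow>\<^sub>L 'a) \<Rightarrow> 'a set \<Rightarrow> 'a set \<Rightarrow> ('a \<Rightarrow>\<^sub>L 'a)" where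
  "reflexive_inverse T S U =
    (THE X. X \<in> bounded_operators \<and> T o\<^sub>L X o\<^sub>L T = T \<and> X o\<^sub>L T o\<^sub>L X = X \<and>
       op_range X = S \<and> op_kernel X = U)"

text \<open>
  Every complement is required explicitly here, since \<open>oblique_proj\<close> is a total function.
  Note that \<open>o\<^sub>L\<close> binds weaker than \<open>+\<close>.
\<close>

definition agrees ::
    "('a::complex_hilbert_space \<Rightarrow>\<^sub>L 'a) \<Rightarrow> ('a \<Rightarrow>\<^sub>L 'a) \<Rightarrow> ('a \<Rightarrow>\<^sub>L 'a) \<Rightarrow> 'a set \<Rightarrow> bool" where
  "agrees A B P M \<longleftrightarrow>
    direct_sum (op_range (A + B)) M UNIV \<and>
    (\<exists>N1 N2. closed_csubspace N1 \<and> closed_csubspace N2 \<and>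
       direct_sum (op_range A) N1 UNIV \<and> direct_sum (op_range B) N2 UNIV \<and>
       (oblique_proj (op_range A) N1 o\<^sub>L P) + (oblique_proj (op_range B) N2 o\<^sub>L (id_blinfun - P))
         = oblique_proj (op_range (A + B)) M)"

definition coagrees ::
    "('a::complex_hilbert_space \<Rightarrow>\<^sub>L 'a) \<Rightarrow> ('a \<Rightarrow>\<^sub>L 'a) \<Rightarrow> ('a \<Rightarrow>\<^sub>L 'a) \<Rightarrow> 'a set \<Rightarrow> bool" where
  "coagrees A B Q N \<longleftrightarrow>
    agrees (cadjoint A) (cadjoint B) (cadjoint Q) (orthogonal_complement N)"

end

theory Submission
  imports Defs
begin

text \<open>
  Put \<open>X = Q A\<^sup>- P + (I - Q) B\<^sup>- (I - P)\<close> and let \<open>Y\<close> be the reflexive inverse of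
  \<open>A + B\<close>. From \<open>(A + B) Q = A\<close>, \<open>P A = A\<close> and \<open>P B = 0\<close> one computes \<open>X (A + B) X = X\<close>,
  and the two agreement conditions become \<open>(A + B) X = (A + B) Y\<close> and
  \<open>X (A + B) = Y (A + B)\<close>. Hence \<open>X = X (A + B) X = Y (A + B) X = Y (A + B) Y = Y\<close>.
  What remains is the existence of reflexive inverses as bounded operators, which is an
  application of the closed graph theorem.
\<close>

subsection \<open>The closed graph theorem\<close>

text \<open>Baire category: if every set had empty interior, so would the countable union, which is
  the whole space.\<close>

lemma closed_sets_covering_has_interior:
  fixes F :: "nat \<Rightarrow> 'a::complete_space set"
  assumes "\<And>n. closed (F n)" and "(\<Union>n. F n) = UNIV"
  shows "\<exists>n. interior (F n) \<noteq> {}"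
proof (rule ccontr)
  assume "\<not> ?thesis"
  then have "euclidean interior_of (\<Union>(range F)) = {}"
    using assms(1)
    by (intro Baire_category_alt) (auto simp: completely_metrizable_space_euclidean)
  then show False
    using assms(2) by simp
qed

text \<open>The Baire half of the closed graph theorem. The closure of some sublevel set of
  \<open>norm (f x)\<close> contains a ball; differences of points near its centre and near its
  boundary, rescaled, approximate any vector with control on \<open>f\<close>.\<close>

lemma linear_densely_bounded:
  fixes f :: "'a::banach \<Rightarrow> 'b::real_normed_vector"
  assumes "linear f"
  obtains K where "\<And>y \<delta>. 0 < \<delta> \<Longrightarrow> \<exists>z. norm (y - z) < \<delta> \<and> norm (f z) \<le> K * norm y"
proof -
  interpret linear f by fact
  \<comment> \<open>Closures are taken because Baire needs closed sets, and sublevel sets of a map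
    not known to be continuous may fail to be closed.\<close>
  define F where "F n = closure {x. norm (f x) \<le> real n}" for n
  have "x \<in> (\<Union>n. F n)" for x
  proof -
    obtain n where "norm (f x) \<le> real n"
      using real_arch_simple by blast
    then show ?thesis
      using closure_subset [of "{x. norm (f x) \<le> real n}"] unfolding F_def by auto
  qed
  then have "(\<Union>n. F n) = UNIV"
    by blast
  then obtain n where "interior (F n) \<noteq> {}"
    using closed_sets_covering_has_interior [of F] by (auto simp: F_def)
  then obtain x0 e where e: "e > 0" and ball: "cball x0 e \<subseteq> F n"
    by (metis ex_in_conv mem_interior_cball)
  \<comment> \<open>On a difference of two points of the sublevel set, \<open>f\<close> has norm at
    most \<open>2 * real n\<close>; rescaling by \<open>norm y / e\<close> gives this
    constant.\<close>
  define K where "K = 2 * real n / e"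
  have "\<exists>z. norm (y - z) < \<delta> \<and> norm (f z) \<le> K * norm y" if "\<delta> > 0" for y \<delta>
  proof (cases "y = 0")
    case True
    then show ?thesis
      using that by (intro exI [of _ 0]) (simp add: zero)
  next
    case False
    \<comment> \<open>The scale makes \<open>norm w = e\<close>, so \<open>x0 + w\<close> stays in
      the closed ball. The tolerance \<eta> is such that two errors, multiplied by \<open>c\<close>,
      add up to \<delta>.\<close>
    define c where "c = norm y / e"
    define w where "w = (1 / c) *\<^sub>R y"
    define \<eta> where "\<eta> = \<delta> / (2 * c)"
    have c: "c > 0" and \<eta>: "\<eta> > 0"
      using False e that by (auto simp: c_def \<eta>_def)
    have cw: "c *\<^sub>R w = y"
      using c by (simp add: w_def)
    have "norm w = e"
      using False e by (simp add: w_def c_def)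
    then have "x0 + w \<in> F n" "x0 \<in> F n"
      using ball e by (auto simp: dist_norm subset_iff)
    then obtain a b where a: "norm (f a) \<le> n" "norm (x0 + w - a) < \<eta>"
        and b: "norm (f b) \<le> n" "norm (x0 - b) < \<eta>"
      unfolding F_def using closure_approachableD [OF _ \<eta>] by (metis (no_types, lifting) dist_norm mem_Collect_eq)
    define z where "z = c *\<^sub>R (a - b)"
    have "y - z = c *\<^sub>R ((x0 + w - a) - (x0 - b))"
      unfolding z_def cw [symmetric] by (simp add: algebra_simps)
    then have "norm (y - z) = c * norm ((x0 + w - a) - (x0 - b))"
      using c by simp
    also have "norm ((x0 + w - a) - (x0 - b)) < 2 * \<eta>"
      using a(2) b(2) norm_triangle_ineq4 [of "x0 + w - a" "x0 - b"] by linarith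
    then have "c * norm ((x0 + w - a) - (x0 - b)) < c * (2 * \<eta>)"
      using c by simp
    also have "\<dots> = \<delta>"
      using c by (simp add: \<eta>_def)
    finally have 1: "norm (y - z) < \<delta>" .
    have "norm (f z) = c * norm (f a - f b)"
      using c by (simp add: z_def scale diff)
    also have "\<dots> \<le> c * (2 * real n)"
      using a(1) b(1) c norm_triangle_ineq4 [of "f a" "f b"] by (intro mult_left_mono) linarith+
    also have "\<dots> = K * norm y"
      by (simp add: c_def K_def)
    finally show ?thesis
      using 1 by blast
  qed
  then show thesis
    using that by blast
qed

text \<open>Repeated approximation with halved error writes \<open>x\<close> as a series whose image
  under \<open>f\<close> converges absolutely; the closed graph identifies the sum of the images
  with \<open>f x\<close>.\<close>

theorem closed_graph_theorem:
  fixes f :: "'a::banach \<Rightarrow> 'b::banach"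
  assumes "linear f"
    and closed_graph: "\<And>X x y. X \<longlonglongrightarrow> x \<Longrightarrow> (\<lambda>n. f (X n)) \<longlonglongrightarrow> y \<Longrightarrow> f x = y"
  shows "bounded_linear f"
proof -
  interpret linear f by fact
  obtain K where K: "\<And>y \<delta>. 0 < \<delta> \<Longrightarrow> \<exists>z. norm (y - z) < \<delta> \<and> norm (f z) \<le> K * norm y"
    using linear_densely_bounded [OF \<open>linear f\<close>] by blast
  \<comment> \<open>Weakening the strict bound admits \<open>y = 0\<close>, so that the
    approximation can be chosen as a function \<open>g\<close> on the whole space.\<close>
  have "\<exists>z. norm (y - z) \<le> norm y / 2 \<and> norm (f z) \<le> K * norm y" for y
  proof (cases "y = 0")
    case True
    then show ?thesis
      by (intro exI [of _ 0]) (simp add: zero)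
  next
    case False
    then show ?thesis
      using K [of "norm y / 2" y] by (auto intro: less_imp_le)
  qed
  then obtain g where g: "\<And>y. norm (y - g y) \<le> norm y / 2" "\<And>y. norm (f (g y)) \<le> K * norm y"
    by metis
  \<comment> \<open>The factor 2 is the sum of the geometric series of ratio 1/2; the absolute value
    is there because the sign of \<open>K\<close> is unknown.\<close>
  have "norm (f x) \<le> norm x * (2 * \<bar>K\<bar>)" for x
  proof -
    \<comment> \<open>\<open>r k\<close> is the remainder after \<open>k\<close> approximations; the
      corrections \<open>g (r i)\<close> telescope to \<open>x - r k\<close>.\<close>
    define r where "r = rec_nat x (\<lambda>_ y. y - g y)"
    have r: "r 0 = x" "r (Suc k) = r k - g (r k)" for k
      by (simp_all add: r_def)
    have rle: "norm (r k) \<le> norm x * (1/2) ^ k" for k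
    proof (induction k)
      case (Suc k)
      then show ?case
        using g(1) [of "r k"] by (simp add: r)
    qed (simp add: r)
    have sum_eq: "(\<Sum>i<k. g (r i)) = x - r k" for k
      by (induction k) (simp_all add: r)
    have "(\<lambda>k. norm x * (1/2) ^ k) \<longlonglongrightarrow> 0"
      by (intro tendsto_mult_right_zero LIMSEQ_realpow_zero) auto
    then have "r \<longlonglongrightarrow> 0"
      by (rule Lim_null_comparison [rotated]) (simp add: rle)
    then have lim: "(\<lambda>k. \<Sum>i<k. g (r i)) \<longlonglongrightarrow> x"
      unfolding sum_eq using tendsto_diff [OF tendsto_const [of x]] by fastforce
    have fle: "norm (f (g (r i))) \<le> \<bar>K\<bar> * norm x * (1/2) ^ i" for i
    proof -
      have "norm (f (g (r i))) \<le> \<bar>K\<bar> * norm (r i)"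
        using g(2) [of "r i"] by (meson abs_ge_self mult_right_mono norm_ge_zero order_trans)
      also have "\<dots> \<le> \<bar>K\<bar> * (norm x * (1/2) ^ i)"
        by (intro mult_left_mono rle) auto
      finally show ?thesis
        by (simp add: mult.assoc)
    qed
    have geo: "(\<lambda>i. \<bar>K\<bar> * norm x * (1/2) ^ i) sums (\<bar>K\<bar> * norm x * 2)"
      using sums_mult [OF geometric_sums [of "1/2::real"]] by simp
    have summable_norm: "summable (\<lambda>i. norm (f (g (r i))))"
      using summable_comparison_test' [OF sums_summable [OF geo], of 0 "\<lambda>i. norm (f (g (r i)))"] fle
      by simp
    then have "summable (\<lambda>i. f (g (r i)))"
      by (rule summable_norm_cancel)
    then have "(\<lambda>k. f (\<Sum>i<k. g (r i))) \<longlonglongrightarrow> (\<Sum>i. f (g (r i)))"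
      by (simp add: sum summable_LIMSEQ)
    then have "f x = (\<Sum>i. f (g (r i)))"
      by (rule closed_graph [OF lim])
    then have "norm (f x) \<le> (\<Sum>i. norm (f (g (r i))))"
      using Series.summable_norm [OF summable_norm] by simp
    also have "\<dots> \<le> (\<Sum>i. \<bar>K\<bar> * norm x * (1/2) ^ i)"
      by (intro suminf_le fle summable_norm sums_summable [OF geo])
    also have "\<dots> = norm x * (2 * \<bar>K\<bar>)"
      using sums_unique [OF geo] by (simp only: mult_ac)
    finally show ?thesis .
  qed
  then show ?thesis
    by (intro bounded_linear_intro) (auto simp: add scale)
qed

subsection \<open>Oblique projections and reflexive inverses\<close>

instance complex_hilbert_space \<subseteq> banach ..

lemma bounded_operators_compose:
  "S \<in> bounded_operators \<Longrightarrow> T \<in> bounded_operators \<Longrightarrow> S o\<^sub>L T \<in> bounded_operators"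
  by (simp add: bounded_operators_def)

lemma bounded_operators_add:
  "S \<in> bounded_operators \<Longrightarrow> T \<in> bounded_operators \<Longrightarrow> S + T \<in> bounded_operators"
  by (simp add: bounded_operators_def blinfun.add_left scaleC_add_right)

text \<open>In \<open>x = E x + (x - E x)\<close>, the map \<open>F\<close> fixes the first summand,
  which lies in its range, and kills the second, which lies in its kernel.\<close>

lemma idempotent_unique:
  assumes "idempotent E" "idempotent F"
    and "op_range E = op_range F" "op_kernel E = op_kernel F"
  shows "E = F"
proof (rule blinfun_eqI)
  fix x
  have EE: "E (E y) = E y" and FF: "F (F y) = F y" for y
    using assms(1,2) unfolding idempotent_def by (metis blinfun_apply_blinfun_compose)+
  have "x - E x \<in> op_kernel F"
    unfolding assms(4) [symmetric] by (simp add: op_kernel_def blinfun.diff_right EE)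
  moreover obtain y where "E x = F y"
    using assms(3) unfolding op_range_def by (metis rangeE rangeI)
  ultimately show "E x = F x"
    by (simp add: op_kernel_def blinfun.diff_right FF)
qed

lemma oblique_proj_eqI:
  assumes "E \<in> bounded_operators" "idempotent E" "op_range E = S" "op_kernel E = U"
  shows "oblique_proj S U = E"
  unfolding oblique_proj_def
proof (rule the_equality)
  fix F
  assume "F \<in> bounded_operators \<and> idempotent F \<and> op_range F = S \<and> op_kernel F = U"
  then show "F = E"
    using assms by (intro idempotent_unique) auto
qed (use assms in auto)

text \<open>
  The value at \<open>x\<close> of the reflexive inverse is the only \<open>s \<in> S\<close> with \<open>x - T s \<in> U\<close>; this
  relation between \<open>x\<close> and \<open>s\<close> is closed, which is what gives boundedness.
\<close>

lemma ex1_reflexive_inverse_value: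
  assumes T: "T \<in> bounded_operators"
    and S: "complex_vector.subspace S" and U: "complex_vector.subspace U"
    and dS: "direct_sum S (op_kernel T) UNIV" and dU: "direct_sum (op_range T) U UNIV"
  shows "\<exists>!s. s \<in> S \<and> x - T s \<in> U"
proof (rule ex_ex1I)
  have "x \<in> {s + t |s t. s \<in> op_range T \<and> t \<in> U}"
    using dU unfolding direct_sum_def by blast
  then obtain y u where y: "x = T y + u" "u \<in> U"
    unfolding op_range_def by blast
  \<comment> \<open>Dropping the kernel component of \<open>y\<close> leaves \<open>T y\<close>
    unchanged, so the preimage can be moved into \<open>S\<close>.\<close>
  have "y \<in> {s + t |s t. s \<in> S \<and> t \<in> op_kernel T}"
    using dS unfolding direct_sum_def by blast
  then obtain s k where s: "y = s + k" "s \<in> S" "k \<in> op_kernel T"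
    by blast
  then have "x - T s = u"
    using y by (simp add: op_kernel_def blinfun.add_right)
  then show "\<exists>s. s \<in> S \<and> x - T s \<in> U"
    using s y by blast
next
  fix s t
  assume s: "s \<in> S \<and> x - T s \<in> U" and t: "t \<in> S \<and> x - T t \<in> U"
  have "T (s - t) \<in> op_range T"
    by (simp add: op_range_def)
  moreover have "T (s - t) = (x - T t) - (x - T s)"
    by (simp add: blinfun.diff_right)
  then have "T (s - t) \<in> U"
    using complex_vector.subspace_diff [OF U] s t by metis
  ultimately have "T (s - t) = 0"
    using dU unfolding direct_sum_def by blast
  then have "s - t \<in> op_kernel T"
    by (simp add: op_kernel_def)
  moreover have "s - t \<in> S"
    using complex_vector.subspace_diff [OF S] s t by blast
  ultimately have "s - t = 0"
    using dS unfolding direct_sum_def by blast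
  then show "s = t"
    by simp
qed

text \<open>This is the predicate inside the definite description of
  \<open>reflexive_inverse\<close>, named so that existence and uniqueness can be stated
  separately.\<close>

definition is_reflexive_inverse ::
    "('a::complex_inner \<Rightarrow>\<^sub>L 'a) \<Rightarrow> 'a set \<Rightarrow> 'a set \<Rightarrow> ('a \<Rightarrow>\<^sub>L 'a) \<Rightarrow> bool" where
  "is_reflexive_inverse T S U X \<longleftrightarrow> X \<in> bounded_operators \<and> T o\<^sub>L X o\<^sub>L T = T \<and> X o\<^sub>L T o\<^sub>L X = X \<and>
     op_range X = S \<and> op_kernel X = U"

text \<open>The map from \<open>x\<close> to its unique value is linear because \<open>S\<close> and
  \<open>U\<close> are subspaces, and bounded because both membership conditions survive limits. The
  algebraic identities then follow from uniqueness of the value.\<close>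

lemma ex_reflexive_inverse:
  fixes T :: "'a::complex_hilbert_space \<Rightarrow>\<^sub>L 'a"
  assumes T: "T \<in> bounded_operators" and S: "closed_csubspace S" and U: "closed_csubspace U"
    and dS: "direct_sum S (op_kernel T) UNIV" and dU: "direct_sum (op_range T) U UNIV"
  shows "\<exists>X. is_reflexive_inverse T S U X"
proof -
  have sS: "complex_vector.subspace S" and cS: "closed S"
    and sU: "complex_vector.subspace U" and cU: "closed U"
    using S U by (auto simp: closed_csubspace_def)
  note ex1 = ex1_reflexive_inverse_value [OF T sS sU dS dU]
  define f where "f x = (THE s. s \<in> S \<and> x - T s \<in> U)" for x
  have f: "f x \<in> S" "x - T (f x) \<in> U" for x
    using theI' [OF ex1 [of x]] by (auto simp: f_def)
  have f_eqI: "f x = s" if "s \<in> S" "x - T s \<in> U" for x s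
    using ex1 [of x] f that by blast
  have f_add: "f (x + y) = f x + f y" for x y
  proof (rule f_eqI)
    show "f x + f y \<in> S"
      by (intro complex_vector.subspace_add sS f)
    have "(x - T (f x)) + (y - T (f y)) \<in> U"
      by (intro complex_vector.subspace_add sU f)
    then show "x + y - T (f x + f y) \<in> U"
      by (simp add: blinfun.add_right algebra_simps)
  qed
  have f_scaleC: "f (c *\<^sub>C x) = c *\<^sub>C f x" for c x
  proof (rule f_eqI)
    show "c *\<^sub>C f x \<in> S"
      by (intro complex_vector.subspace_scale sS f)
    have "c *\<^sub>C (x - T (f x)) \<in> U"
      by (intro complex_vector.subspace_scale sU f)
    then show "c *\<^sub>C x - T (c *\<^sub>C f x) \<in> U"
      using T by (simp add: bounded_operators_def complex_vector.scale_right_diff_distrib)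
  qed
  \<comment> \<open>The closed graph theorem concerns real linear maps, so real scaling is read as
    complex scaling by \<open>of_real\<close>.\<close>
  have "linear f"
    by (rule linearI) (simp_all add: f_add f_scaleC flip: scaleC_of_real)
  then have "bounded_linear f"
  proof (rule closed_graph_theorem)
    fix X x y
    assume X: "X \<longlonglongrightarrow> x" and fX: "(\<lambda>n. f (X n)) \<longlonglongrightarrow> y"
    have "(\<lambda>n. X n - T (f (X n))) \<longlonglongrightarrow> x - T y"
      by (intro tendsto_intros X fX)
    then have "x - T y \<in> U"
      by (rule closed_sequentially [OF cU f(2)])
    moreover have "y \<in> S"
      by (rule closed_sequentially [OF cS f(1) fX])
    ultimately show "f x = y"
      by (intro f_eqI)
  qed
  then have X: "blinfun_apply (Blinfun f) = f"
    by (rule bounded_linear_Blinfun_apply)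
  have f_in_S: "f (T s) = s" if "s \<in> S" for s
    using that by (intro f_eqI) (simp_all add: complex_vector.subspace_0 sU)
  have f_zero: "f x = 0 \<longleftrightarrow> x \<in> U" for x
    using f(2) [of x] f_eqI [of 0 x] complex_vector.subspace_0 [OF sS]
    by (auto simp: blinfun.zero_right)
  have "T (f (T x)) = T x" for x
  proof -
    have "T x - T (f (T x)) \<in> op_range T"
      by (simp add: op_range_def flip: blinfun.diff_right)
    then have "T x - T (f (T x)) = 0"
      using f(2) dU unfolding direct_sum_def by blast
    then show ?thesis
      by simp
  qed
  moreover have "range f = S"
    using f(1) f_in_S by (metis image_subsetI rangeI subsetI subset_antisym)
  ultimately have "is_reflexive_inverse T S U (Blinfun f)"
    unfolding is_reflexive_inverse_def bounded_operators_def op_range_def op_kernel_def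
    by (auto intro!: blinfun_eqI simp: X f_scaleC f_zero f_in_S f)
  then show ?thesis
    by blast
qed

text \<open>This is the link between the two notions: \<open>T X T = T\<close> and
  \<open>X T X = X\<close> make both products idempotent and let them inherit their ranges and
  kernels from \<open>T\<close> and \<open>X\<close>.\<close>

lemma is_reflexive_inverse_projections:
  assumes "T \<in> bounded_operators" and "is_reflexive_inverse T S U X"
  shows "T o\<^sub>L X = oblique_proj (op_range T) U" and "X o\<^sub>L T = oblique_proj S (op_kernel T)"
proof -
  have X: "X \<in> bounded_operators" and TXT: "T o\<^sub>L X o\<^sub>L T = T" and XTX: "X o\<^sub>L T o\<^sub>L X = X"
    and S: "op_range X = S" and U: "op_kernel X = U"
    using assms(2) by (auto simp: is_reflexive_inverse_def)
  have TXT': "T (X (T x)) = T x" and XTX': "X (T (X x)) = X x" for x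
    using TXT XTX by (metis blinfun_apply_blinfun_compose)+
  have r: "op_range (T o\<^sub>L X) = op_range T" "op_range (X o\<^sub>L T) = S"
    unfolding S [symmetric] op_range_def by (auto simp: image_def) (metis TXT' XTX')+
  have k: "op_kernel (T o\<^sub>L X) = U" "op_kernel (X o\<^sub>L T) = op_kernel T"
    unfolding U [symmetric] op_kernel_def
    by auto (metis TXT' XTX' blinfun.zero_right)+
  have i: "idempotent (T o\<^sub>L X)" "idempotent (X o\<^sub>L T)"
    unfolding idempotent_def by (auto intro!: blinfun_eqI simp: TXT' XTX')
  show "T o\<^sub>L X = oblique_proj (op_range T) U" "X o\<^sub>L T = oblique_proj S (op_kernel T)"
    using oblique_proj_eqI bounded_operators_compose assms(1) X r k i by metis+
qed

lemma blinfun_compose_assoc: "(R o\<^sub>L S) o\<^sub>L T = R o\<^sub>L (S o\<^sub>L T)"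
  by (rule blinfun_eqI) simp

text \<open>Both products with \<open>T\<close> agree with those of \<open>Y\<close>, so each can be
  exchanged in \<open>X T X\<close>. The range and kernel of the candidate \<open>X\<close> thus
  never have to be computed.\<close>

lemma reflexive_inverse_eqI:
  assumes T: "T \<in> bounded_operators" and Y: "is_reflexive_inverse T S U Y"
    and "T o\<^sub>L X = oblique_proj (op_range T) U" "X o\<^sub>L T = oblique_proj S (op_kernel T)"
    and "X o\<^sub>L T o\<^sub>L X = X"
  shows "X = Y"
proof -
  note Y_proj = is_reflexive_inverse_projections [OF T Y]
  have "X = Y o\<^sub>L T o\<^sub>L X"
    using assms(4,5) Y_proj(2) by simp
  also have "\<dots> = Y o\<^sub>L T o\<^sub>L Y"
    using assms(3) Y_proj(1) by (metis blinfun_compose_assoc)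
  also have "\<dots> = Y"
    using Y by (simp add: is_reflexive_inverse_def)
  finally show ?thesis .
qed

lemma is_reflexive_inverse_unique:
  fixes T :: "'a::complex_hilbert_space \<Rightarrow>\<^sub>L 'a"
  assumes T: "T \<in> bounded_operators"
    and X: "is_reflexive_inverse T S U X" and Y: "is_reflexive_inverse T S U Y"
  shows "X = Y"
  using reflexive_inverse_eqI [OF T Y] is_reflexive_inverse_projections [OF T X] X
  by (simp add: is_reflexive_inverse_def)

lemma is_reflexive_inverse_reflexive_inverse:
  fixes T :: "'a::complex_hilbert_space \<Rightarrow>\<^sub>L 'a"
  assumes T: "T \<in> bounded_operators" and "closed_csubspace S" and "closed_csubspace U"
    and "direct_sum S (op_kernel T) UNIV" and "direct_sum (op_range T) U UNIV"
  shows "is_reflexive_inverse T S U (reflexive_inverse T S U)"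
proof -
  have "\<exists>!X. is_reflexive_inverse T S U X"
    using ex_reflexive_inverse [OF assms] is_reflexive_inverse_unique [OF T] by blast
  then show ?thesis
    unfolding reflexive_inverse_def is_reflexive_inverse_def by (rule theI')
qed

section \<open>The reflexive inverse of a sum\<close>

theorem theorem4p7:
  fixes A B P Q :: "'a::complex_hilbert_space \<Rightarrow>\<^sub>L 'a"
    and M N N1 N2 N1s N2s :: "'a set"
  assumes "A \<in> bounded_operators" and "B \<in> bounded_operators"
    and "closed (op_range (A + B))"
    and "direct_sum (op_range A) (op_range B) (op_range (A + B))"
    and "closed_csubspace M" and "closed_csubspace N"
    and "direct_sum (op_range (A + B)) M UNIV"
    and "direct_sum N (op_kernel (A + B)) UNIV"
    and "P \<in> bounded_operators" and "Q \<in> bounded_operators"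
    and "idempotent P" and "idempotent Q"
    and "A = P o\<^sub>L (A + B)" and "A = (A + B) o\<^sub>L Q"
    and "agrees A B P M" and "coagrees A B Q N"
    and "closed_csubspace N1" and "closed_csubspace N2"
    and "direct_sum (op_range A) N1 UNIV" and "direct_sum (op_range B) N2 UNIV"
    and "(oblique_proj (op_range A) N1 o\<^sub>L P) + (oblique_proj (op_range B) N2 o\<^sub>L (id_blinfun - P))
           = oblique_proj (op_range (A + B)) M"
    and "closed_csubspace N1s" and "closed_csubspace N2s"
    and "direct_sum N1s (op_kernel A) UNIV" and "direct_sum N2s (op_kernel B) UNIV"
    and "(Q o\<^sub>L oblique_proj N1s (op_kernel A)) + ((id_blinfun - Q) o\<^sub>L oblique_proj N2s (op_kernel B))
           = oblique_proj N (op_kernel (A + B))"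
  shows "reflexive_inverse (A + B) N M =
           (Q o\<^sub>L reflexive_inverse A N1s N1 o\<^sub>L P) +
           ((id_blinfun - Q) o\<^sub>L reflexive_inverse B N2s N2 o\<^sub>L (id_blinfun - P))"
proof -
  define C where "C = A + B"
  note AB = assms(1,2)
  have C: "C \<in> bounded_operators"
    unfolding C_def by (intro bounded_operators_add AB)
  define X1 where "X1 = reflexive_inverse A N1s N1"
  define X2 where "X2 = reflexive_inverse B N2s N2"
  define X where "X = (Q o\<^sub>L X1 o\<^sub>L P) + ((id_blinfun - Q) o\<^sub>L X2 o\<^sub>L (id_blinfun - P))"
  have X1: "is_reflexive_inverse A N1s N1 X1"
    unfolding X1_def using assms(1,17,19,22,24) by (intro is_reflexive_inverse_reflexive_inverse)
  have X2: "is_reflexive_inverse B N2s N2 X2"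
    unfolding X2_def using assms(2,18,20,23,25) by (intro is_reflexive_inverse_reflexive_inverse)
  have Y: "is_reflexive_inverse C N M (reflexive_inverse C N M)"
    using C assms(5-8) unfolding C_def by (intro is_reflexive_inverse_reflexive_inverse)
  note proj1 = is_reflexive_inverse_projections [OF AB(1) X1]
  note proj2 = is_reflexive_inverse_projections [OF AB(2) X2]
  have C_apply: "C x = A x + B x" for x
    by (simp add: C_def blinfun.add_left)
  have PC: "P (C x) = A x" for x
    using assms(13) unfolding C_def by (metis blinfun_apply_blinfun_compose)
  have CQ: "C (Q x) = A x" for x
    using assms(14) unfolding C_def by (metis blinfun_apply_blinfun_compose)
  have PP: "P (P x) = P x" for x
    using assms(11) unfolding idempotent_def by (metis blinfun_apply_blinfun_compose)
  have PA: "P (A x) = A x" for x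
    by (metis PC PP)
  have PB: "P (B x) = 0" for x
    using PC [of x] PA [of x] by (simp add: C_apply blinfun.add_right)
  have X1': "X1 (A (X1 x)) = X1 x" for x
    using X1 unfolding is_reflexive_inverse_def by (metis blinfun_apply_blinfun_compose)
  have X2': "X2 (B (X2 x)) = X2 x" for x
    using X2 unfolding is_reflexive_inverse_def by (metis blinfun_apply_blinfun_compose)
  \<comment> \<open>Since \<open>C Q = A\<close>, also \<open>C (I - Q) = B\<close>; composing with
    \<open>C\<close> therefore removes both left factors of \<open>X\<close>.\<close>
  have CX: "C (X x) = A (X1 (P x)) + B (X2 (x - P x))" for x
    by (simp add: X_def blinfun.add_left blinfun.diff_left blinfun.add_right blinfun.diff_right CQ
        C_apply [of "X2 _"])
  \<comment> \<open>\<open>P\<close> is the identity on the range of \<open>A\<close> and zero on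
    that of \<open>B\<close>, so only one summand of \<open>X\<close> survives on each
    range.\<close>
  have XA: "X (A x) = Q (X1 (A x))" and XB: "X (B x) = X2 (B x) - Q (X2 (B x))" for x
    by (simp_all add: X_def blinfun.add_left blinfun.diff_left PA PB blinfun.zero_right)
  have "C o\<^sub>L X = (A o\<^sub>L X1 o\<^sub>L P) + (B o\<^sub>L X2 o\<^sub>L (id_blinfun - P))"
    by (intro blinfun_eqI) (simp add: CX blinfun.add_left blinfun.diff_left)
  \<comment> \<open>By \<open>proj1\<close> and \<open>proj2\<close>, \<open>A X1\<close> and
    \<open>B X2\<close> are the oblique projections in the agreement condition for
    \<open>M\<close>.\<close>
  then have 1: "C o\<^sub>L X = oblique_proj (op_range C) M"
    using assms(21) unfolding proj1 proj2 C_def by simp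
  have "X o\<^sub>L C = (Q o\<^sub>L (X1 o\<^sub>L A)) + ((id_blinfun - Q) o\<^sub>L (X2 o\<^sub>L B))"
    by (intro blinfun_eqI)
      (simp add: C_apply XA XB blinfun.add_left blinfun.diff_left blinfun.add_right)
  then have 2: "X o\<^sub>L C = oblique_proj N (op_kernel C)"
    using assms(26) unfolding proj1 proj2 C_def by simp
  \<comment> \<open>After \<open>CX\<close>, \<open>X\<close> acts on one vector from each range,
    and reflexivity of \<open>X1\<close> and \<open>X2\<close> restores the two summands.\<close>
  have "X (C (X x)) = X x" for x
    unfolding CX by (simp add: blinfun.add_right XA XB X1' X2')
      (simp add: X_def blinfun.add_left blinfun.diff_left)
  then have "X o\<^sub>L C o\<^sub>L X = X"
    by (intro blinfun_eqI) simp
  with C Y 1 2 have "X = reflexive_inverse C N M"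
    by (rule reflexive_inverse_eqI)
  then show ?thesis
    by (simp add: X_def X1_def X2_def C_def)
qed

end
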